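(* Let $F$ be a connected graph with constant link $L$, order $k$ and circumference $c$, where $3 \leq c \leq k$. Then, for all integers $t \geq 2$ and $g > c$, there exists a connected graph $G_{t,F,g}$ with constant link $tL$ which contains no cycle of length $\ell$ for any $c < \ell < g$.
   Context: All graphs are finite and simple. A graph $G$ has constant link $L$ if for every vertex $v$ of $G$ the subgraph $G[N(v)]$ induced by the open neighborhood of $v$ is isomorphic to $L$. $tL$ denotes the disjoint union of $t$ copies of $L$. The circumference of a graph is the length of a longest cycle in it. The order of a graph is its number of vertices. *)

theory Defs
  imports "Graph_Theory.Graph_Theory"
begin

text \<open>
  Finite simple graphs are modelled by the locale \<^locale>\<open>pair_graph\<close>: finitely many vertices and an
  irreflexive, symmetric arc relation, an edge being a pair of opposite arcs.
\<close>

definition open_nbhd :: "'a pair_pre_digraph \<Rightarrow> 'a \<Rightarrow> 'a set" where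
  "open_nbhd G v = {u. (v, u) \<in> parcs G}"

definition has_constant_link :: "'a pair_pre_digraph \<Rightarrow> 'b pair_pre_digraph \<Rightarrow> bool" where
  "has_constant_link G L \<longleftrightarrow>
     (\<forall>v \<in> pverts G. digraph_iso (with_proj G \<restriction> open_nbhd G v) (with_proj L))"

definition copies :: "nat \<Rightarrow> 'a pair_pre_digraph \<Rightarrow> ('a \<times> nat) pair_pre_digraph" where
  "copies t L = \<lparr> pverts = pverts L \<times> {..<t},
                  parcs = {((x, i), (y, i)) | x y i. (x, y) \<in> parcs L \<and> i < t} \<rparr>"

text \<open>
  The library counts an edge traversed back and forth as a cycle of length 2; in a simple graph
  these are exactly the directed cycles that are not cycles of the undirected graph.
\<close>

definition cycle_lengths :: "'a pair_pre_digraph \<Rightarrow> nat set" where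
  "cycle_lengths G = {length p | p. pre_digraph.cycle (with_proj G) p \<and> 3 \<le> length p}"

text \<open>By convention, forests have circumference 0.\<close>

definition circumference :: "'a pair_pre_digraph \<Rightarrow> nat" where
  "circumference G = Max (insert 0 (cycle_lengths G))"

end

theory Submission
  imports Defs "HOL-Combinatorics.Permutations"
begin

text \<open>
  Glue copies of \<open>F\<close> (blocks) so that every vertex lies in \<open>t\<close> blocks and the pattern of blocks
  and vertices has large girth. Then links are disjoint unions of \<open>t\<close> copies of \<open>L\<close>, a short cycle
  stays in one block, and a cycle in a block has length at most \<open>c\<close>. The pattern is a voltage
  lift: the voltages are involutions, one for each pair of a vertex of \<open>F\<close> and a block type
  below \<open>t\<close>, acting on words without equal adjacent letters of length at most \<open>n\<close> by adding or
  cancelling the first letter. A short closed walk through several blocks would move the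
  empty word to a nonempty one, so it cannot exist.
\<close>

section \<open>Links and cycles of simple graphs\<close>

text \<open>A nonempty walk in a pair digraph is determined by its vertices, so arc walks can be
  traded for closed vertex sequences. Cycles are later projected and pulled back in this
  form.\<close>

lemma in_cycle_lengths_iff:
  assumes "pair_wf_digraph G"
  shows "l \<in> cycle_lengths G \<longleftrightarrow>
    3 \<le> l \<and> (\<exists>p. p 0 = p l \<and> inj_on p {..<l} \<and> (\<forall>j<l. (p j, p (Suc j)) \<in> parcs G))"
    (is "?L \<longleftrightarrow> ?R")
proof -
  interpret pair_wf_digraph G by fact
  show ?thesis
  proof
    assume ?L
    then obtain es u where es: "length es = l" "3 \<le> l" "awalk u es u"
      "distinct (tl (pawalk_verts u es))"
      by (auto simp: cycle_lengths_def cycle_def)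
    have verts: "pawalk_verts u es = map fst es @ [snd (last es)]"
      using awalk_verts_conv[of u es] es by auto
    have verts': "pawalk_verts u es = fst (hd es) # map snd es"
      using awalk_verts_conv'[of u es u] es unfolding awalk_def by auto
    define p where "p j = pawalk_verts u es ! j" for j
    have p_fst: "p j = fst (es ! j)" if "j < l" for j
      using that es by (simp add: p_def verts nth_append)
    have p_snd: "p (Suc j) = snd (es ! j)" if "j < l" for j
      using that es by (simp add: p_def verts')
    have closed: "p 0 = p l"
    proof -
      have "hd (pawalk_verts u es) = u" "last (pawalk_verts u es) = u"
        using es(3) by (auto elim: awalkE)
      moreover have "pawalk_verts u es \<noteq> []" "length (pawalk_verts u es) = Suc l"
        using es by (simp_all add: verts')
      ultimately show ?thesis
        by (simp add: p_def hd_conv_nth last_conv_nth)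
    qed
    have "inj_on p {..<l}"
    proof (rule inj_onI)
      \<comment> \<open>\<open>cycle\<close> gives distinctness of \<open>p 1, ..., p l\<close>,
        while the goal concerns \<open>p 0, ..., p (l - 1)\<close>. As \<open>p 0 = p l\<close>,
        \<open>pred j\<close> is a position of \<open>p j\<close> in the tail of the vertex
        list.\<close>
      define pred where "pred j = (if j = 0 then l - 1 else j - 1)" for j
      have *: "p j = tl (pawalk_verts u es) ! pred j" if "j < l" for j
        using that closed es by (cases j) (auto simp: p_def nth_tl verts' pred_def)
      fix i j assume ij: "i \<in> {..<l}" "j \<in> {..<l}" "p i = p j"
      then have "pred i < length (tl (pawalk_verts u es))" "pred j < length (tl (pawalk_verts u es))"
        using es(1) by (auto simp: verts' pred_def)
      then have "pred i = pred j"
        using *[of i] *[of j] ij nth_eq_iff_index_eq[OF es(4)] by simp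
      then show "i = j" using ij by (auto simp: pred_def split: if_splits)
    qed
    moreover have "(p j, p (Suc j)) \<in> parcs G" if "j < l" for j
    proof -
      have "es ! j \<in> parcs G" using es(1,3) that unfolding awalk_def by auto
      then show ?thesis using that by (simp add: p_fst p_snd)
    qed
    ultimately show ?R using es closed by blast
  next
    assume ?R
    then obtain p where p: "3 \<le> l" "p 0 = p l" "inj_on p {..<l}"
      "\<And>j. j < l \<Longrightarrow> (p j, p (Suc j)) \<in> parcs G" by blast
    define es where "es = map (\<lambda>j. (p j, p (Suc j))) [0..<l]"
    have cas: "pcas (p i) (map (\<lambda>j. (p j, p (Suc j))) [i..<i+n]) (p (i+n))" for i n
      
    proof (induction n arbitrary: i)
      case (Suc n)
      then show ?case using Suc[of "Suc i"] by (simp add: upt_conv_Cons del: upt_Suc)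
    qed simp
    have "awalk (p 0) es (p 0)"
      using p cas[of 0 l] in_arcsD1[OF p(4)[of 0]] by (auto simp: awalk_def es_def)
    moreover have "tl (pawalk_verts (p 0) es) = map (p \<circ> Suc) [0..<l]"
      using awalk_verts_conv'[of "p 0" es "p 0"] calculation p(1)
      by (auto simp: awalk_def es_def comp_def)
    moreover have "distinct (map (p \<circ> Suc) [0..<l])"
    proof -
      \<comment> \<open>Injectivity below \<open>l\<close> leaves open only a collision with
        \<open>p l\<close>, which \<open>p l = p 0\<close> settles.\<close>
      have "p (Suc a) \<noteq> p (Suc b)" if "a < b" "b < l" for a b
        using inj_onD[OF p(3), of "Suc a" "Suc b"] inj_onD[OF p(3), of "Suc a" 0] p(2) that
        by (cases "Suc b = l") auto
      then have "inj_on (p \<circ> Suc) {..<l}"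
        by (auto intro!: inj_onI) (metis nat_neq_iff)
      then show ?thesis by (simp add: distinct_map lessThan_atLeast0 del: comp_apply)
    qed
    moreover have "length es = l" "es \<noteq> []" using p(1) by (auto simp: es_def)
    ultimately have "cycle es" "length es = l"
      unfolding cycle_def by (auto simp del: map_map)
    then show ?L using p(1) unfolding cycle_lengths_def by auto
  qed
qed

lemma cycle_length_le_card:
  assumes "pair_fin_digraph G" "l \<in> cycle_lengths G"
  shows "l \<le> card (pverts G)"
proof -
  interpret pair_fin_digraph G by fact
  obtain p where p: "inj_on p {..<l}" "\<And>j. j < l \<Longrightarrow> (p j, p (Suc j)) \<in> parcs G"
    using assms(2) in_cycle_lengths_iff[OF pair_wf_digraph_axioms] by blast
  have "p ` {..<l} \<subseteq> pverts G" using p(2) in_arcsD1 by blast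
  from card_mono[OF pair_finite_verts this] show ?thesis by (simp add: card_image p(1))
qed

text \<open>Cycle lengths are bounded by the number of vertices, so the \<open>Max\<close> in
  \<open>circumference\<close> is taken over a finite set.\<close>

lemma cycle_length_le_circumference:
  assumes "pair_fin_digraph G" "l \<in> cycle_lengths G"
  shows "l \<le> circumference G"
proof -
  have "finite (cycle_lengths G)"
    using cycle_length_le_card[OF assms(1)] by (auto intro: finite_subset[of _ "{..card (pverts G)}"])
  then show ?thesis using assms(2) by (simp add: circumference_def)
qed

text \<open>Tail and head are \<open>fst\<close> and \<open>snd\<close> on both sides, which forces
  the arc map of an isomorphism to act componentwise as the vertex map. What remains is a vertex
  bijection that preserves and reflects arcs.\<close>

lemma digraph_iso_induced_iff:
  assumes "pair_wf_digraph L"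
  shows "digraph_iso (with_proj G \<restriction> S) (with_proj L) \<longleftrightarrow>
    (\<exists>h. bij_betw h S (pverts L) \<and>
      (\<forall>x\<in>S. \<forall>y\<in>S. (x, y) \<in> parcs G \<longleftrightarrow> (h x, h y) \<in> parcs L))"
    (is "?L \<longleftrightarrow> ?R")
proof
  assume ?L
  then obtain f where f: "pre_digraph.digraph_isomorphism (with_proj G \<restriction> S) f"
      "with_proj L = app_iso f (with_proj G \<restriction> S)"
    by (auto simp: digraph_iso_def)
  have L: "pverts L = iso_verts f ` S" "iso_tail f = fst" "iso_head f = snd"
    "parcs L = iso_arcs f ` {a \<in> parcs G. fst a \<in> S \<and> snd a \<in> S}"
    using arg_cong[OF f(2), of verts] arg_cong[OF f(2), of arcs]
      arg_cong[OF f(2), of tail] arg_cong[OF f(2), of head]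
    by (auto simp: induce_subgraph_def)
  have inj: "inj_on (iso_verts f) S"
    using f(1) by (auto simp: pre_digraph.digraph_isomorphism_def)
  have arc: "iso_arcs f (x, y) = (iso_verts f x, iso_verts f y)"
    if "(x, y) \<in> parcs G" "x \<in> S" "y \<in> S" for x y
    using f(1) that L(2,3) by (auto simp: pre_digraph.digraph_isomorphism_def induce_subgraph_def
        prod_eq_iff)
  have "(x, y) \<in> parcs G \<longleftrightarrow> (iso_verts f x, iso_verts f y) \<in> parcs L" if "x \<in> S" "y \<in> S" for x y
  proof
    assume "(x, y) \<in> parcs G"
    then show "(iso_verts f x, iso_verts f y) \<in> parcs L"
      using that arc[of x y] L(4) by (auto intro!: image_eqI[of _ _ "(x, y)"])
  next
    assume "(iso_verts f x, iso_verts f y) \<in> parcs L"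
    then obtain x' y' where "(x', y') \<in> parcs G" "x' \<in> S" "y' \<in> S"
      "iso_arcs f (x', y') = (iso_verts f x, iso_verts f y)"
      using L(4) by auto
    then show "(x, y) \<in> parcs G" using arc[of x' y'] inj that by (auto dest: inj_onD)
  qed
  then show ?R using L(1) inj by (auto simp: bij_betw_def)
next
  interpret L: pair_wf_digraph L by fact
  assume ?R
  then obtain h where h: "bij_betw h S (pverts L)"
    "\<And>x y. x \<in> S \<Longrightarrow> y \<in> S \<Longrightarrow> (x, y) \<in> parcs G \<longleftrightarrow> (h x, h y) \<in> parcs L" by blast
  define f where "f = \<lparr>iso_verts = h, iso_arcs = map_prod h h, iso_head = snd, iso_tail = fst\<rparr>"
  have "pre_digraph.digraph_isomorphism (with_proj G \<restriction> S) f"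
    using h(1) by (auto simp: pre_digraph.digraph_isomorphism_def f_def induce_subgraph_def
        bij_betw_def inj_on_def wf_digraph_def)
  moreover have "parcs L = map_prod h h ` {a \<in> parcs G. fst a \<in> S \<and> snd a \<in> S}"
  proof (rule set_eqI)
    fix a
    show "a \<in> parcs L \<longleftrightarrow> a \<in> map_prod h h ` {a \<in> parcs G. fst a \<in> S \<and> snd a \<in> S}"
    proof
      assume a: "a \<in> parcs L"
      then have "fst a \<in> h ` S" "snd a \<in> h ` S"
        using L.arc_fst_in_verts L.arc_snd_in_verts h(1) by (auto simp: bij_betw_def)
      then obtain x y where xy: "x \<in> S" "y \<in> S" "a = (h x, h y)" by (cases a) auto
      then have "(x, y) \<in> {a \<in> parcs G. fst a \<in> S \<and> snd a \<in> S}" using h(2) a by auto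
      then show "a \<in> map_prod h h ` {a \<in> parcs G. fst a \<in> S \<and> snd a \<in> S}"
        using xy(3) by force
    next
      assume "a \<in> map_prod h h ` {a \<in> parcs G. fst a \<in> S \<and> snd a \<in> S}"
      then show "a \<in> parcs L" using h(2) by auto
    qed
  qed
  ultimately show ?L
    using h(1) unfolding digraph_iso_def
    by (intro exI[of _ f]) (simp add: app_iso_def f_def induce_subgraph_def with_proj_def bij_betw_def)
qed

lemma has_constant_link_iff:
  assumes "pair_wf_digraph L"
  shows "has_constant_link G L \<longleftrightarrow> (\<forall>v \<in> pverts G. \<exists>h. bij_betw h (open_nbhd G v) (pverts L) \<and>
    (\<forall>x \<in> open_nbhd G v. \<forall>y \<in> open_nbhd G v. (x, y) \<in> parcs G \<longleftrightarrow> (h x, h y) \<in> parcs L))"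
  by (simp add: has_constant_link_def digraph_iso_induced_iff[OF assms])

lemma pair_graph_iff:
  "pair_graph G \<longleftrightarrow> finite (pverts G) \<and> parcs G \<subseteq> pverts G \<times> pverts G \<and>
    sym (parcs G) \<and> irrefl (parcs G)" (is "?L \<longleftrightarrow> ?R")
proof
  assume ?L
  then interpret pair_graph G .
  show ?R using pair_finite_verts arcs_symmetric no_loops'
    by (auto simp: sym_def irrefl_def dest: in_arcsD1 in_arcsD2)
next
  assume R: ?R
  then have "finite (parcs G)" by (meson finite_SigmaI finite_subset)
  then show ?L using R by unfold_locales (auto simp: symmetric_def irrefl_def)
qed

lemma pair_graph_copies:
  assumes "pair_graph L"
  shows "pair_graph (copies t L)"
  using assms by (auto simp: pair_graph_iff copies_def sym_def irrefl_def)

text \<open>Connectedness means strong connectedness of the symmetric closure. Here the arc relation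
  is already symmetric, so paths from one root can be reversed and joined.\<close>

lemma connected_if_reachable_from:
  assumes "pair_graph G" "r \<in> pverts G" "\<And>u. u \<in> pverts G \<Longrightarrow> (r, u) \<in> (parcs G)\<^sup>*"
  shows "Digraph_Component.connected (with_proj G)"
proof -
  interpret pair_graph G by fact
  have pverts: "pverts (mk_symmetric (with_proj G)) = pverts G"
    by (simp add: mk_symmetric_def)
  have eq: "parcs (mk_symmetric (with_proj G)) = parcs G"
    using arcs_symmetric by (force simp: mk_symmetric_def)
  interpret H: pair_wf_digraph "mk_symmetric (with_proj G)"
    using arc_fst_in_verts arc_snd_in_verts by unfold_locales (auto simp: eq pverts)
  have "sym ((parcs G)\<^sup>*)" using arcs_symmetric by (intro sym_rtrancl symI)
  then have "(u, v) \<in> (parcs G)\<^sup>*" if "u \<in> pverts G" "v \<in> pverts G" for u v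
    using assms(3) that by (meson rtrancl_trans symD)
  then show ?thesis
    using assms(2) unfolding connected_def strongly_connected_def
    by (auto simp: H.reachable_conv eq pverts)
qed

section \<open>Connected components\<close>

definition component :: "'a pair_pre_digraph \<Rightarrow> 'a \<Rightarrow> 'a pair_pre_digraph" where
  "component G r = \<lparr> pverts = {u. (r, u) \<in> (parcs G)\<^sup>*},
                     parcs = {(u, v) \<in> parcs G. (r, u) \<in> (parcs G)\<^sup>*} \<rparr>"

context
  fixes G :: "'a pair_pre_digraph" and r :: 'a
  assumes G: "pair_graph G" and r: "r \<in> pverts G"
begin

interpretation pair_graph G by (rule G)

lemma pverts_component_subset: "pverts (component G r) \<subseteq> pverts G"
proof
  fix u assume "u \<in> pverts (component G r)"
  then have "(r, u) \<in> (parcs G)\<^sup>*" by (simp add: component_def)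
  then show "u \<in> pverts G" by induction (auto simp: r dest: in_arcsD2)
qed

lemma pair_graph_component: "pair_graph (component G r)"
  using G finite_subset[OF pverts_component_subset]
  by (auto simp: pair_graph_iff component_def sym_def irrefl_def intro: rtrancl_into_rtrancl)

lemma connected_component: "Digraph_Component.connected (with_proj (component G r))"
proof (rule connected_if_reachable_from[OF pair_graph_component])
  show "r \<in> pverts (component G r)" by (simp add: component_def)
  fix u assume "u \<in> pverts (component G r)"
  then have "(r, u) \<in> (parcs G)\<^sup>*" by (simp add: component_def)
  then show "(r, u) \<in> (parcs (component G r))\<^sup>*"
  proof induction
    case (step u v)
    then have "(u, v) \<in> parcs (component G r)" by (simp add: component_def)
    with step show ?case by simp
  qed simp
qed

text \<open>A component contains all neighbours of each of its vertices and all arcs among them, so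
  links in it are the links in \<open>G\<close>.\<close>

lemma has_constant_link_component:
  assumes "pair_wf_digraph L" "has_constant_link G L"
  shows "has_constant_link (component G r) L"
  unfolding has_constant_link_iff[OF assms(1)]
proof
  fix v assume v: "v \<in> pverts (component G r)"
  have nbhd: "open_nbhd (component G r) v = open_nbhd G v"
    using v by (auto simp: open_nbhd_def component_def)
  have arc: "(x, y) \<in> parcs (component G r) \<longleftrightarrow> (x, y) \<in> parcs G" if "x \<in> open_nbhd G v" for x y
    using v that by (auto simp: open_nbhd_def component_def intro: rtrancl_into_rtrancl)
  obtain h where "bij_betw h (open_nbhd G v) (pverts L)"
    "\<forall>x\<in>open_nbhd G v. \<forall>y\<in>open_nbhd G v. (x, y) \<in> parcs G \<longleftrightarrow> (h x, h y) \<in> parcs L"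
    using assms(2) v pverts_component_subset unfolding has_constant_link_iff[OF assms(1)] by blast
  then show "\<exists>h. bij_betw h (open_nbhd (component G r) v) (pverts L) \<and>
    (\<forall>x\<in>open_nbhd (component G r) v. \<forall>y\<in>open_nbhd (component G r) v.
      ((x, y) \<in> parcs (component G r)) = ((h x, h y) \<in> parcs L))"
    unfolding nbhd by (intro exI[of _ h]) (simp add: arc)
qed

lemma cycle_lengths_component: "cycle_lengths (component G r) \<subseteq> cycle_lengths G"
proof -
  interpret C: pair_graph "component G r" by (rule pair_graph_component)
  show ?thesis
    by (auto simp: in_cycle_lengths_iff[OF pair_wf_digraph_axioms]
        in_cycle_lengths_iff[OF C.pair_wf_digraph_axioms])
      (auto simp: component_def)
qed

end

section \<open>Injective renaming of vertices\<close>

definition relabel :: "('a \<Rightarrow> 'b) \<Rightarrow> 'a pair_pre_digraph \<Rightarrow> 'b pair_pre_digraph" where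
  "relabel e G = \<lparr> pverts = e ` pverts G, parcs = map_prod e e ` parcs G \<rparr>"

context
  fixes G :: "'a pair_pre_digraph" and e :: "'a \<Rightarrow> 'b"
  assumes G: "pair_graph G" and inj: "inj_on e (pverts G)"
begin

interpretation pair_graph G by (rule G)

lemma relabel_arc_iff:
  "u \<in> pverts G \<Longrightarrow> v \<in> pverts G \<Longrightarrow> (e u, e v) \<in> parcs (relabel e G) \<longleftrightarrow> (u, v) \<in> parcs G"
  by (auto simp: relabel_def dest: in_arcsD1 in_arcsD2 inj_onD[OF inj])

lemma pair_graph_relabel: "pair_graph (relabel e G)"
  unfolding pair_graph_iff
proof (intro conjI)
  show "finite (pverts (relabel e G))" by (simp add: relabel_def pair_finite_verts)
  show "parcs (relabel e G) \<subseteq> pverts (relabel e G) \<times> pverts (relabel e G)"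
    by (auto simp: relabel_def dest: in_arcsD1 in_arcsD2)
  show "sym (parcs (relabel e G))"
    using arcs_symmetric by (force simp: relabel_def sym_def)
  show "irrefl (parcs (relabel e G))"
    using no_loops' inj by (auto simp: relabel_def irrefl_def dest: inj_onD in_arcsD1 in_arcsD2)
qed

lemma has_constant_link_relabel:
  assumes L: "pair_wf_digraph L" and link: "has_constant_link G L"
  shows "has_constant_link (relabel e G) L"
  unfolding has_constant_link_iff[OF L]
proof
  fix v' assume "v' \<in> pverts (relabel e G)"
  then obtain v where v: "v' = e v" "v \<in> pverts G" by (auto simp: relabel_def)
  let ?N = "open_nbhd G v"
  have N: "?N \<subseteq> pverts G" by (auto simp: open_nbhd_def dest: in_arcsD2)
  have N': "open_nbhd (relabel e G) v' = e ` ?N"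
    using v N relabel_arc_iff[OF v(2)]
    by (auto simp: open_nbhd_def relabel_def dest!: inj_onD[OF inj] dest: in_arcsD1)
  obtain h where h: "bij_betw h ?N (pverts L)"
    "\<And>x y. x \<in> ?N \<Longrightarrow> y \<in> ?N \<Longrightarrow> (x, y) \<in> parcs G \<longleftrightarrow> (h x, h y) \<in> parcs L"
    using link v(2) unfolding has_constant_link_iff[OF L] by meson
  let ?e' = "the_inv_into (pverts G) e"
  have inv: "?e' (e x) = x" if "x \<in> ?N" for x using inj N that by (auto intro: the_inv_into_f_f)
  have "bij_betw ?e' (e ` ?N) ?N"
    using inv by (auto simp: bij_betw_def inj_on_def image_image)
  then have "bij_betw (h \<circ> ?e') (e ` ?N) (pverts L)" using h(1) by (rule bij_betw_trans)
  then show "\<exists>h. bij_betw h (open_nbhd (relabel e G) v') (pverts L) \<and>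
    (\<forall>x\<in>open_nbhd (relabel e G) v'. \<forall>y\<in>open_nbhd (relabel e G) v'.
      ((x, y) \<in> parcs (relabel e G)) = ((h x, h y) \<in> parcs L))"
    unfolding N' using inv h(2) N by (auto simp: relabel_arc_iff subsetD intro!: exI[of _ "h \<circ> ?e'"])
qed

lemma connected_relabel:
  assumes "Digraph_Component.connected (with_proj G)"
  shows "Digraph_Component.connected (with_proj (relabel e G))"
proof -
  have sc: "strongly_connected (with_proj G)"
    using assms pair_sym_arcs by (intro symmetric_connected_imp_strongly_connected)
  then obtain r where r: "r \<in> pverts G" by (auto simp: strongly_connected_def)
  have "(e u, e v) \<in> (parcs (relabel e G))\<^sup>*" if "(u, v) \<in> (parcs G)\<^sup>*" for u v
    using that
  proof induction
    case (step v w)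
    then have "(e v, e w) \<in> parcs (relabel e G)" by (auto simp: relabel_def)
    with step show ?case by simp
  qed simp
  moreover have "(r, u) \<in> (parcs G)\<^sup>*" if "u \<in> pverts G" for u
    using sc r that by (auto simp: strongly_connected_def reachable_conv)
  ultimately show ?thesis using r
    by (intro connected_if_reachable_from[OF pair_graph_relabel, of "e r"]) (auto simp: relabel_def)
qed

lemma cycle_lengths_relabel: "cycle_lengths (relabel e G) \<subseteq> cycle_lengths G"
proof
  interpret R: pair_graph "relabel e G" by (rule pair_graph_relabel)
  fix l assume "l \<in> cycle_lengths (relabel e G)"
  then obtain p where p: "3 \<le> l" "p 0 = p l" "inj_on p {..<l}"
      "\<And>j. j < l \<Longrightarrow> (p j, p (Suc j)) \<in> parcs (relabel e G)"
    unfolding in_cycle_lengths_iff[OF R.pair_wf_digraph_axioms] by blast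
  define q where "q = the_inv_into (pverts G) e \<circ> p"
  \<comment> \<open>Arcs with tail \<open>p j\<close> are given for \<open>j < l\<close> only; the
    closing equation covers \<open>j = l\<close>.\<close>
  have p_verts: "p j \<in> e ` pverts G" if "j \<le> l" for j
    using R.in_arcsD1[OF p(4)[of j]] R.in_arcsD1[OF p(4)[of 0]] p(1,2) that
    by (cases "j = l") (auto simp: relabel_def)
  have q: "q j \<in> pverts G" "e (q j) = p j" if "j \<le> l" for j
    using p_verts[OF that] inj by (auto simp: q_def the_inv_into_f_f f_the_inv_into_f)
  have "(q j, q (Suc j)) \<in> parcs G" if "j < l" for j
    using q[of j] q[of "Suc j"] p(4)[OF that] that relabel_arc_iff[of "q j" "q (Suc j)"] by simp
  moreover have "inj_on q {..<l}"
  proof (rule inj_onI)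
    fix i j assume "i \<in> {..<l}" "j \<in> {..<l}" "q i = q j"
    then show "i = j" using q(2)[of i] q(2)[of j] by (auto intro: inj_onD[OF p(3)])
  qed
  ultimately show "l \<in> cycle_lengths G"
    using p(1,2) unfolding in_cycle_lengths_iff[OF pair_wf_digraph_axioms]
    by (intro conjI exI[of _ q]) (simp_all add: q_def)
qed

end

section \<open>Involutions acting on a ball of the regular tree\<close>

text \<open>The elements of length at most \<open>n\<close> in the free product of copies of Z/2
  indexed by \<open>A\<close>: a ball in a regular tree. For finite \<open>A\<close> the length
  bound makes this set, and hence the lift, finite.\<close>

definition reduced_words :: "'a set \<Rightarrow> nat \<Rightarrow> 'a list set" where
  "reduced_words A n = {w. set w \<subseteq> A \<and> distinct_adj w \<and> length w \<le> n}"

text \<open>For a letter \<open>a\<close> of \<open>A\<close> this is left multiplication by the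
  generator \<open>a\<close>, truncated: a word whose product would leave the ball is fixed. Words
  outside the ball are fixed too, as \<open>permutes\<close> demands.\<close>

definition flip :: "'a set \<Rightarrow> nat \<Rightarrow> 'a \<Rightarrow> 'a list \<Rightarrow> 'a list" where
  "flip A n a w =
     (if a # w \<in> reduced_words A n then a # w
      else if w \<in> reduced_words A n \<and> w \<noteq> [] \<and> hd w = a then tl w
      else w)"

lemma finite_reduced_words: "finite A \<Longrightarrow> finite (reduced_words A n)"
  by (rule finite_subset[OF _ finite_lists_length_le[of A n]]) (auto simp: reduced_words_def)

text \<open>Prepending and cancelling \<open>a\<close> undo each other, and a word that allows
  neither is fixed, so the truncation preserves the involution.\<close>

lemma flip_flip: "flip A n a (flip A n a w) = w"
  by (cases w) (auto simp: flip_def reduced_words_def)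

lemma flip_comp_flip: "flip A n a \<circ> flip A n a = id"
  by (simp add: fun_eq_iff flip_flip)

lemma flip_permutes: "flip A n a permutes reduced_words A n"
proof -
  have "flip A n a w = w" if "w \<notin> reduced_words A n" for w
    using that by (auto simp: flip_def reduced_words_def dest: distinct_adj_ConsD)
  then show ?thesis unfolding permutes_def by (metis flip_flip)
qed

lemma flip_push:
  "a \<in> A \<Longrightarrow> w \<in> reduced_words A n \<Longrightarrow> length w < n \<Longrightarrow> w = [] \<or> hd w \<noteq> a \<Longrightarrow>
    flip A n a w = a # w"
  by (auto simp: flip_def reduced_words_def distinct_adj_Cons)

lemma flip_pop: "a # w \<in> reduced_words A n \<Longrightarrow> flip A n a (a # w) = w"
  by (auto simp: flip_def reduced_words_def)

text \<open>After \<open>j\<close> steps the word ends with the two letters that span the current run of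
  equal \<open>i\<close>; continuing the run replaces the last letter, changing \<open>i\<close> adds two letters.\<close>

lemma flip_walk_nonempty:
  fixes v :: "nat \<Rightarrow> 'v" and i :: "nat \<Rightarrow> 'i"
  assumes start: "w 0 = []"
    and step: "\<And>j. j < l \<Longrightarrow> w (Suc j) = flip A n (v (Suc j), i j) (flip A n (v j, i j) (w j))"
    and letters: "\<And>j. j < l \<Longrightarrow> (v j, i j) \<in> A \<and> (v (Suc j), i j) \<in> A"
    and run: "\<And>a b. a < b \<Longrightarrow> b \<le> l \<Longrightarrow> (\<And>m. a \<le> m \<Longrightarrow> m < b \<Longrightarrow> i m = i a) \<Longrightarrow> v a \<noteq> v b"
    and "0 < l" "2 * l \<le> n"
  shows "w l \<noteq> []"
proof -
  have "\<exists>a u. a \<le> j \<and> w (Suc j) = (v (Suc j), i j) # (v a, i j) # u \<and>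
      w (Suc j) \<in> reduced_words A n \<and> length (w (Suc j)) \<le> 2 * Suc j \<and>
      (\<forall>m. a \<le> m \<longrightarrow> m \<le> j \<longrightarrow> i m = i j)" if "j < l" for j
    using that
  proof (induction j)
    case 0
    have "v 0 \<noteq> v (Suc 0)" using run[of 0 "Suc 0"] 0 by force
    moreover have "flip A n (v 0, i 0) [] = [(v 0, i 0)]"
      using letters[OF 0] 0 \<open>2 * l \<le> n\<close> by (intro flip_push) (auto simp: reduced_words_def)
    moreover have "flip A n (v (Suc 0), i 0) [(v 0, i 0)] = [(v (Suc 0), i 0), (v 0, i 0)]"
      using letters[OF 0] 0 \<open>2 * l \<le> n\<close> calculation(1)
      by (intro flip_push) (auto simp: reduced_words_def)
    ultimately show ?case
      using step[OF 0] letters[OF 0] 0 start \<open>2 * l \<le> n\<close> by (auto simp: reduced_words_def)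
  next
    case (Suc j)
    from Suc.IH[OF Suc_lessD[OF Suc.prems]] obtain a u where IH: "a \<le> j" "w (Suc j) = (v (Suc j), i j) # (v a, i j) # u"
      "w (Suc j) \<in> reduced_words A n" "length (w (Suc j)) \<le> 2 * Suc j"
      "\<And>m. a \<le> m \<Longrightarrow> m \<le> j \<Longrightarrow> i m = i j" by blast
    \<comment> \<open>There is room for two more letters, so neither flip of this step meets the
      truncation.\<close>
    have len: "length (w (Suc j)) + 2 \<le> n" using IH(4) Suc.prems \<open>2 * l \<le> n\<close> by simp
    note lett = letters[OF Suc.prems]
    show ?case
    proof (cases "i (Suc j) = i j")
      case True
      have same: "i m = i j" if "a \<le> m" "m \<le> Suc j" for m
        using that IH(5)[of m] True by (cases "m = Suc j") auto
      then have same': "\<forall>m. a \<le> m \<longrightarrow> m \<le> Suc j \<longrightarrow> i m = i (Suc j)"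
        unfolding True by blast
      \<comment> \<open>Within a run the first flip cancels the front letter and the second prepends
        a new one. By \<open>run\<close>, the new letter differs from \<open>(v a, i j)\<close>
        below it and does not cancel it.\<close>
      have "v a \<noteq> v (Suc (Suc j))"
      proof (rule run)
        fix m assume "a \<le> m" "m < Suc (Suc j)"
        then show "i m = i a" using same[of m] same[of a] IH(1) by simp
      qed (use IH(1) Suc.prems in simp_all)
      moreover have "flip A n (v (Suc j), i j) (w (Suc j)) = (v a, i j) # u"
        using IH(2,3) by (simp add: flip_pop)
      moreover have red: "(v a, i j) # u \<in> reduced_words A n"
        using IH(2,3) by (auto simp: reduced_words_def)
      ultimately have "w (Suc (Suc j)) = (v (Suc (Suc j)), i j) # (v a, i j) # u"
        using step[OF Suc.prems] True lett len IH(2) by (auto intro!: flip_push)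
      moreover have "\<dots> \<in> reduced_words A n"
        using red lett len IH(2) True \<open>v a \<noteq> v (Suc (Suc j))\<close> by (auto simp: reduced_words_def)
      ultimately show ?thesis
        using IH(1,2,4) True by (intro exI[of _ a] exI[of _ u] conjI same') simp_all
    next
      case False
      \<comment> \<open>At a change of type the first flip prepends, since its letter has another
        type than the front letter. The second prepends as well, by \<open>run\<close> for a stretch
        of length one.\<close>
      have "v (Suc j) \<noteq> v (Suc (Suc j))"
      proof (rule run)
        fix m assume "Suc j \<le> m" "m < Suc (Suc j)"
        then have "m = Suc j" by simp
        then show "i m = i (Suc j)" by simp
      qed (use Suc.prems in simp_all)
      moreover have push1: "flip A n (v (Suc j), i (Suc j)) (w (Suc j)) =
          (v (Suc j), i (Suc j)) # w (Suc j)"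
        using IH(2,3) len lett False by (intro flip_push) auto
      moreover have red: "(v (Suc j), i (Suc j)) # w (Suc j) \<in> reduced_words A n"
        using IH(2,3) len lett False by (auto simp: reduced_words_def)
      ultimately have "w (Suc (Suc j)) =
          (v (Suc (Suc j)), i (Suc j)) # (v (Suc j), i (Suc j)) # w (Suc j)"
        using step[OF Suc.prems] len lett by (auto intro!: flip_push)
      moreover have "\<dots> \<in> reduced_words A n"
        using red len lett \<open>v (Suc j) \<noteq> v (Suc (Suc j))\<close> by (auto simp: reduced_words_def)
      ultimately show ?thesis
        using IH(4) by (intro exI[of _ "Suc j"] exI[of _ "w (Suc j)"]) auto
    qed
  qed
  then obtain x u where "w (Suc (l - 1)) = x # u" using \<open>0 < l\<close> diff_less zero_less_one by blast
  then show ?thesis using \<open>0 < l\<close> by simp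
qed

section \<open>Gluing copies of a graph along a tree-like pattern\<close>

text \<open>Each vertex lies in \<open>t\<close> blocks, and each block contains exactly one vertex of every
  role \<open>v \<in> pverts F\<close>; the block of type \<open>i\<close> through \<open>(x, v)\<close> is
  represented by the permutation that its members share.\<close>

locale tree_lift = pair_graph F for F :: "'v pair_pre_digraph" +
  fixes t n :: nat
begin

abbreviation letters :: "('v \<times> nat) set" where
  "letters \<equiv> pverts F \<times> {..<t}"

text \<open>As flips are involutions, \<open>(x, v)\<close> and \<open>(y, w)\<close> have the same
  block of type \<open>i\<close> iff \<open>y\<close> arises from \<open>x\<close> by composing with
  the flips of \<open>(v, i)\<close> and then \<open>(w, i)\<close>. A step inside a block thus
  costs two flips.\<close>

definition block :: "nat \<Rightarrow> (('v \<times> nat) list \<Rightarrow> ('v \<times> nat) list) \<times> 'v \<Rightarrow>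
    ('v \<times> nat) list \<Rightarrow> ('v \<times> nat) list" where
  "block i p = flip letters n (snd p, i) \<circ> fst p"

text \<open>Vertices carry whole permutations rather than words, so that a walk from any vertex can
  be tested on the word that its initial permutation sends to \<open>[]\<close>, far from the
  truncation.\<close>

definition lift :: "((('v \<times> nat) list \<Rightarrow> ('v \<times> nat) list) \<times> 'v) pair_pre_digraph" where
  "lift = (let V = {x. x permutes reduced_words letters n} \<times> pverts F in
    \<lparr> pverts = V,
      parcs = {(p, q). p \<in> V \<and> q \<in> V \<and> (snd p, snd q) \<in> parcs F \<and>
                 (\<exists>i<t. block i p = block i q)} \<rparr>)"

lemma mem_pverts_lift:
  "p \<in> pverts lift \<longleftrightarrow> fst p permutes reduced_words letters n \<and> snd p \<in> pverts F"
  by (cases p) (simp add: lift_def Let_def)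

lemma mem_parcs_lift:
  "(p, q) \<in> parcs lift \<longleftrightarrow> p \<in> pverts lift \<and> q \<in> pverts lift \<and> (snd p, snd q) \<in> parcs F \<and>
    (\<exists>i<t. block i p = block i q)"
  by (simp add: lift_def Let_def)

lemma fst_eq_flip_block: "fst p = flip letters n (snd p, i) \<circ> block i p"
  by (simp add: block_def o_assoc flip_comp_flip)

text \<open>A flip is its own inverse, so block and role determine the permutation: a block has at
  most one vertex per role.\<close>

lemma block_eq_imp_eq: "block i p = block i q \<Longrightarrow> snd p = snd q \<Longrightarrow> p = q"
  by (metis fst_eq_flip_block prod_eqI)

lemma pair_graph_lift: "pair_graph lift"
  unfolding pair_graph_iff
proof (intro conjI)
  have "finite {x. x permutes reduced_words letters n}"
    by (intro finite_permutations finite_reduced_words) (simp add: pair_finite_verts)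
  then show "finite (pverts lift)" by (simp add: lift_def Let_def pair_finite_verts)
  show "parcs lift \<subseteq> pverts lift \<times> pverts lift" by (auto simp: mem_parcs_lift)
  show "sym (parcs lift)"
    by (rule symI) (metis mem_parcs_lift arcs_symmetric prod.collapse)
  show "irrefl (parcs lift)" by (auto simp: irrefl_def mem_parcs_lift dest: no_loops')
qed

text \<open>If the type changed, the two ends of every stretch of constant type would have different
  roles. Then \<open>flip_walk_nonempty\<close> would move \<open>[]\<close> to a nonempty word,
  although the walk closes up.\<close>

lemma closed_walk_in_one_block:
  assumes l: "0 < l" "2 * l \<le> n"
    and closed: "p 0 = p l" and inj: "inj_on p {..<l}"
    and verts: "\<And>j. j < l \<Longrightarrow> p j \<in> pverts lift"
    and blocks: "\<And>j. j < l \<Longrightarrow> i j < t \<and> block (i j) (p j) = block (i j) (p (Suc j))"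
    and "j < l"
  shows "i j = i 0"
proof (rule ccontr)
  assume "i j \<noteq> i 0"
  have verts': "p j \<in> pverts lift" if "j \<le> l" for j
    using verts[of j] verts[of 0] closed l(1) that by (cases "j = l") auto
  \<comment> \<open>Equal roles at the ends of a stretch inside one block force equal vertices. By
    injectivity the stretch is then the whole walk, which contradicts the change of type.\<close>
  have run: "snd (p a) \<noteq> snd (p b)"
    if ab: "a < b" "b \<le> l" and const: "\<And>m. a \<le> m \<Longrightarrow> m < b \<Longrightarrow> i m = i a" for a b
  proof
    assume eq: "snd (p a) = snd (p b)"
    have "m < b \<longrightarrow> block (i a) (p a) = block (i a) (p (Suc m))" if "a \<le> m" for m
      using that
    proof (induction m rule: dec_induct)
      case base
      then show ?case using blocks[of a] ab by simp
    next
      case (step m)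
      have "block (i a) (p (Suc m)) = block (i a) (p (Suc (Suc m)))" if "Suc m < b"
        using blocks[of "Suc m"] const[of "Suc m"] step(1) that ab(2) by simp
      then show ?case using step by auto
    qed
    from this[of "b - 1"] have "block (i a) (p a) = block (i a) (p b)" using ab(1) by simp
    then have pab: "p a = p b" using eq by (rule block_eq_imp_eq)
    show False
    proof (cases "b = l")
      case True
      then have "a = 0" using pab closed inj_onD[OF inj, of a 0] ab l(1) by simp
      then show False using const[of j] True \<open>j < l\<close> \<open>i j \<noteq> i 0\<close> by simp
    next
      case False
      then show False using pab inj_onD[OF inj, of a b] ab by simp
    qed
  qed
  \<comment> \<open>The permutation at the start sends \<open>q\<close> to \<open>[]\<close>;
    \<open>w\<close> follows the image of \<open>q\<close> along the walk.\<close>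
  define q where "q = inv (fst (p 0)) []"
  define w where "w j = fst (p j) q" for j
  have "fst (p 0) q = []"
    using verts[OF l(1)] by (auto simp: q_def mem_pverts_lift permutes_inverses)
  then have "w 0 = []" by (simp add: w_def)
  moreover have "w (Suc j) = flip letters n (snd (p (Suc j)), i j) (flip letters n (snd (p j), i j) (w j))"
    if "j < l" for j
  proof -
    have "w (Suc j) = flip letters n (snd (p (Suc j)), i j) (block (i j) (p (Suc j)) q)"
      unfolding w_def by (subst fst_eq_flip_block[of "p (Suc j)" "i j"]) simp
    also have "\<dots> = flip letters n (snd (p (Suc j)), i j) (block (i j) (p j) q)"
      using blocks[OF that] by simp
    finally show ?thesis by (simp add: block_def w_def)
  qed
  moreover have "(snd (p j), i j) \<in> letters \<and> (snd (p (Suc j)), i j) \<in> letters" if "j < l" for j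
    using verts'[of j] verts'[of "Suc j"] blocks[OF that] that by (simp add: mem_pverts_lift)
  ultimately have "w l \<noteq> []"
    using run l by (rule flip_walk_nonempty[where v = "\<lambda>j. snd (p j)" and i = i])
  then show False using \<open>w 0 = []\<close> closed by (simp add: w_def)
qed

text \<open>Going out through one block and back through the other is a closed walk of length 2,
  whence the bound \<open>4\<close>.\<close>

lemma block_type_unique:
  assumes "4 \<le> n" "p \<in> pverts lift" "q \<in> pverts lift" "p \<noteq> q"
    and "i < t" "block i p = block i q" "j < t" "block j p = block j q"
  shows "i = j"
proof -
  let ?p = "\<lambda>m::nat. if m = 1 then q else p" and ?i = "\<lambda>m::nat. if m = 0 then i else j"
  have "?i 1 = ?i 0"
    by (rule closed_walk_in_one_block[of 2 ?p])
      (use assms in \<open>auto simp: inj_on_def less_2_cases_iff\<close>)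
  then show ?thesis by simp
qed

text \<open>The three vertices form a closed walk of length 3, whence the bound
  \<open>6\<close>.\<close>

lemma block_type_triangle:
  assumes "6 \<le> n" "p \<in> pverts lift" "q \<in> pverts lift" "r \<in> pverts lift" "distinct [p, q, r]"
    and "i < t" "block i p = block i q" "m < t" "block m q = block m r"
      "j < t" "block j p = block j r"
  shows "i = m \<and> i = j"
proof -
  let ?p = "\<lambda>a::nat. if a = 1 then q else if a = 2 then r else p"
  let ?i = "\<lambda>a::nat. if a = 0 then i else if a = 1 then m else j"
  have lt3: "a < 3 \<longleftrightarrow> a = 0 \<or> a = 1 \<or> a = 2" for a :: nat by auto
  have "?i a = ?i 0" if "a < 3" for a
    by (rule closed_walk_in_one_block[of 3 ?p])
      (use assms that in \<open>auto simp: inj_on_def lt3\<close>)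
  from this[of 1] this[of 2] show ?thesis by simp
qed

text \<open>Neighbours of \<open>p\<close> are sorted by the type of the block shared with
  \<open>p\<close>. Those of one type correspond by role to the neighbours of \<open>snd p\<close>
  in \<open>F\<close>, giving a copy of \<open>L\<close>; an arc between different types would
  contradict \<open>block_type_triangle\<close>.\<close>

lemma has_constant_link_lift:
  assumes n: "6 \<le> n" and L: "pair_graph L" and link: "has_constant_link F L"
  shows "has_constant_link lift (copies t L)"
proof -
  interpret L: pair_graph L by fact
  interpret C: pair_graph "copies t L" using L by (rule pair_graph_copies)
  show ?thesis
    unfolding has_constant_link_iff[OF C.pair_wf_digraph_axioms]
  proof
    fix p assume p: "p \<in> pverts lift"
    let ?N = "open_nbhd F (snd p)" and ?M = "open_nbhd lift p"
    obtain h where h: "bij_betw h ?N (pverts L)"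
      "\<And>v w. v \<in> ?N \<Longrightarrow> w \<in> ?N \<Longrightarrow> (v, w) \<in> parcs F \<longleftrightarrow> (h v, h w) \<in> parcs L"
      using link p unfolding has_constant_link_iff[OF L.pair_wf_digraph_axioms]
      by (auto simp: mem_pverts_lift)
    define ty where "ty q = (SOME i. i < t \<and> block i p = block i q)" for q
    have M: "q \<in> pverts lift" "snd q \<in> ?N" "p \<noteq> q" "ty q < t" "block (ty q) p = block (ty q) q"
      if "q \<in> ?M" for q
    proof -
      show "q \<in> pverts lift" "snd q \<in> ?N" "p \<noteq> q"
        using that no_loops' by (auto simp: open_nbhd_def mem_parcs_lift)
      have "\<exists>i. i < t \<and> block i p = block i q"
        using that by (auto simp: open_nbhd_def mem_parcs_lift)
      from someI_ex[OF this] show "ty q < t" "block (ty q) p = block (ty q) q"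
        by (auto simp: ty_def)
    qed
    have ty_eq: "ty q = i" if "q \<in> ?M" "i < t" "block i p = block i q" for q i
      using block_type_unique[OF _ p M(1)[OF that(1)] M(3)[OF that(1)] M(4)[OF that(1)]
          M(5)[OF that(1)] that(2,3)] n by simp
    let ?H = "\<lambda>q. (h (snd q), ty q)"
    have "bij_betw ?H ?M (pverts (copies t L))"
      unfolding bij_betw_def
    proof
      show "inj_on ?H ?M"
      proof (rule inj_onI)
        fix q r assume qr: "q \<in> ?M" "r \<in> ?M" "?H q = ?H r"
        then have "snd q = snd r"
          using M(2)[OF qr(1)] M(2)[OF qr(2)] h(1) by (auto simp: bij_betw_def dest: inj_onD)
        then show "q = r"
          using block_eq_imp_eq[of "ty q" q r] M(5)[OF qr(1)] M(5)[OF qr(2)] qr(3) by simp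
      qed
      show "?H ` ?M = pverts (copies t L)"
      proof
        show "?H ` ?M \<subseteq> pverts (copies t L)"
          using M(2,4) h(1) by (auto simp: copies_def bij_betw_def)
        show "pverts (copies t L) \<subseteq> ?H ` ?M"
        proof
          fix z assume z: "z \<in> pverts (copies t L)"
          then have "fst z \<in> h ` ?N" "snd z < t"
            using h(1) by (auto simp: copies_def bij_betw_def)
          then obtain v i where vi: "z = (h v, i)" "v \<in> ?N" "i < t" by (cases z) auto
          \<comment> \<open>The vertex of role \<open>v\<close> in the block of type
            \<open>i\<close> through \<open>p\<close>, found by solving the equation for
            \<open>block\<close>.\<close>
          define q where "q = (flip letters n (v, i) \<circ> block i p, v)"
          have "block i q = block i p" by (simp add: q_def block_def o_assoc flip_comp_flip)
          moreover have "q \<in> pverts lift"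
            using p vi(2) flip_permutes
            by (auto simp: mem_pverts_lift q_def block_def open_nbhd_def intro!: permutes_compose
                dest: in_arcsD2)
          ultimately have q: "q \<in> ?M"
            using p vi by (auto simp: open_nbhd_def mem_parcs_lift q_def)
          then have "ty q = i" using \<open>block i q = block i p\<close> vi(3) by (intro ty_eq) simp_all
          then have "z = ?H q" using vi(1) by (simp add: q_def)
          then show "z \<in> ?H ` ?M" using q by (rule image_eqI)
        qed
      qed
    qed
    moreover have "(q, r) \<in> parcs lift \<longleftrightarrow> (?H q, ?H r) \<in> parcs (copies t L)"
      if q: "q \<in> ?M" and r: "r \<in> ?M" for q r
    proof -
      have arc: "(snd q, snd r) \<in> parcs F \<longleftrightarrow> (h (snd q), h (snd r)) \<in> parcs L"
        using h(2) M(2) q r by blast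
      \<comment> \<open>An arc from \<open>q\<close> to \<open>r\<close> closes a triangle with
        \<open>p\<close>, so all three block types agree.\<close>
      have same: "ty q = ty r" if qr: "(snd q, snd r) \<in> parcs F" "m < t" "block m q = block m r" for m
        using block_type_triangle[OF n p M(1)[OF q] M(1)[OF r] _ M(4,5)[OF q] qr(2,3) M(4,5)[OF r]]
          M(3)[OF q] M(3)[OF r] no_loops'[OF qr(1)] by auto
      have "block (ty q) q = block (ty q) r" if "ty q = ty r"
        using M(5)[OF q] M(5)[OF r] that by simp
      then have "(q, r) \<in> parcs lift \<longleftrightarrow> (snd q, snd r) \<in> parcs F \<and> ty q = ty r"
        unfolding mem_parcs_lift using M(1,4)[OF q] M(1)[OF r] same by blast
      then show ?thesis using M(4)[OF q] arc by (auto simp: copies_def)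
    qed
    ultimately show "\<exists>h. bij_betw h ?M (pverts (copies t L)) \<and>
      (\<forall>x\<in>?M. \<forall>y\<in>?M. (x, y) \<in> parcs lift \<longleftrightarrow> (h x, h y) \<in> parcs (copies t L))"
      by blast
  qed
qed

text \<open>Such a cycle stays in one block, where roles distinguish vertices, so \<open>snd\<close>
  maps it to a cycle of the same length in \<open>F\<close>.\<close>

lemma short_cycle_lengths_lift:
  assumes "l \<in> cycle_lengths lift" "2 * l \<le> n"
  shows "l \<in> cycle_lengths F"
proof -
  interpret G: pair_graph lift by (rule pair_graph_lift)
  obtain p where p: "3 \<le> l" "p 0 = p l" "inj_on p {..<l}"
      "\<And>j. j < l \<Longrightarrow> (p j, p (Suc j)) \<in> parcs lift"
    using assms(1) unfolding in_cycle_lengths_iff[OF G.pair_wf_digraph_axioms] by blast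
  have "\<forall>j. \<exists>i. j < l \<longrightarrow> i < t \<and> block i (p j) = block i (p (Suc j))"
    using p(4) unfolding mem_parcs_lift by blast
  then obtain i where i: "j < l \<Longrightarrow> i j < t \<and> block (i j) (p j) = block (i j) (p (Suc j))" for j
    by metis
  have "p j \<in> pverts lift" if "j < l" for j
    using p(4)[OF that] by (rule G.in_arcsD1)
  then have one: "i j = i 0" if "j < l" for j
    using p(1) by (intro closed_walk_in_one_block[OF _ assms(2) p(2,3) _ i that]) simp_all
  have step: "block (i 0) (p j) = block (i 0) (p (Suc j))" if "j < l" for j
    using i[OF that] unfolding one[OF that] by simp
  have const: "j \<le> l \<longrightarrow> block (i 0) (p j) = block (i 0) (p 0)" for j
    by (induction j) (auto simp: step[symmetric])
  have "snd (p a) = snd (p b) \<Longrightarrow> p a = p b" if "a < l" "b < l" for a b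
    using const[of a] const[of b] that by (intro block_eq_imp_eq[of "i 0"]) simp_all
  then have "inj_on (snd \<circ> p) {..<l}"
    using p(3) by (auto simp: inj_on_def)
  then show ?thesis
    unfolding in_cycle_lengths_iff[OF pair_wf_digraph_axioms]
    using p(1,2,4) by (intro conjI exI[of _ "snd \<circ> p"]) (simp_all add: mem_parcs_lift)
qed

end

section \<open>The graph for given \<open>t\<close> and \<open>g\<close>\<close>

theorem theorem6:
  fixes F :: "'a pair_pre_digraph" and L :: "'b pair_pre_digraph" and k c :: nat
  assumes "pair_graph F" and "Digraph_Component.connected (with_proj F)"
    and "pair_graph L" and "has_constant_link F L"
    and "card (pverts F) = k" and "circumference F = c"
    and "3 \<le> c" and "c \<le> k"
  shows "\<forall>t\<ge>2. \<forall>g>c. \<exists>G :: nat pair_pre_digraph.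
           pair_graph G \<and> Digraph_Component.connected (with_proj G) \<and>
           has_constant_link G (copies t L) \<and>
           (\<forall>l. c < l \<and> l < g \<longrightarrow> l \<notin> cycle_lengths G)"
proof (intro allI impI)
  fix t g :: nat assume "g > c"
  \<comment> \<open>The radius \<open>2 * g\<close> covers closed walks of every length
    \<open>l < g\<close>, and it is at least \<open>6\<close> because \<open>g > c\<close> and
    \<open>c\<close> is at least 3.\<close>
  interpret T: tree_lift F t "2 * g" using assms(1) by (simp add: tree_lift_def)
  have "pverts F \<noteq> {}" using assms(5,7,8) by auto
  then obtain v where "v \<in> pverts F" by blast
  then have r: "(id, v) \<in> pverts T.lift" by (simp add: T.mem_pverts_lift permutes_id)
  let ?K = "component T.lift (id, v)"
  interpret copies: pair_graph "copies t L" using assms(3) by (rule pair_graph_copies)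
  have K: "pair_graph ?K" "Digraph_Component.connected (with_proj ?K)"
    using pair_graph_component[OF T.pair_graph_lift r]
      connected_component[OF T.pair_graph_lift r] by auto
  have link: "has_constant_link ?K (copies t L)"
    using T.has_constant_link_lift[OF _ assms(3,4)] assms(7) \<open>g > c\<close>
    by (intro has_constant_link_component[OF T.pair_graph_lift r] copies.pair_wf_digraph_axioms) simp
  have "finite (pverts ?K)" using K(1) by (simp add: pair_graph_iff)
  \<comment> \<open>The vertices of the component are pairs of a permutation and a role;
    \<open>e\<close> turns them into the natural numbers that the claim asks for.\<close>
  then obtain e :: "_ \<Rightarrow> nat" where e: "inj_on e (pverts ?K)"
    using finite_imp_inj_to_nat_seg by blast
  have "l \<notin> cycle_lengths (relabel e ?K)" if "c < l" "l < g" for l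
  proof
    assume "l \<in> cycle_lengths (relabel e ?K)"
    then have "l \<in> cycle_lengths T.lift"
      using cycle_lengths_relabel[OF K(1) e] cycle_lengths_component[OF T.pair_graph_lift r] by blast
    then have "l \<in> cycle_lengths F" using that by (intro T.short_cycle_lengths_lift) simp_all
    then show False
      using cycle_length_le_circumference[OF T.pair_fin_digraph_axioms] assms(6) that by fastforce
  qed
  then show "\<exists>G :: nat pair_pre_digraph.
           pair_graph G \<and> Digraph_Component.connected (with_proj G) \<and>
           has_constant_link G (copies t L) \<and>
           (\<forall>l. c < l \<and> l < g \<longrightarrow> l \<notin> cycle_lengths G)"
    using pair_graph_relabel[OF K(1) e] connected_relabel[OF K(1) e K(2)]
      has_constant_link_relabel[OF K(1) e copies.pair_wf_digraph_axioms link] by blast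
qed

end
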